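(* Consider regular $s$-striped uncoded and coded storage systems with a total of $R=Ws$ drives and $T/s$ file chunks in each stripe set, where $T/s$ is an integer, and where each drive is blocked in each timeslot with probability $P_b^D>0$, independently of the other drives and of previous timeslots. (i) Assume that at timeslot $t$ the leader in the uncoded system has completely decoded $r$ out of $s$ stripe sets, where $r\in\{0,\dots,s-1\}$, such that its knowledge space rank satisfies $rT/s\le r_\ell(t)<(r+1)T/s$. Then its internal blocking probability is $$P_b^u=(P_b^D)^{Ws-Wr}.$$ (ii) Now assume that in the coded system the leader's knowledge space rank is also $r_\ell(t)$. Then a simple upper bound $P_{b,ub}^c$ for its internal blocking probability is given by $$(P_b^D)^{Ws-r}\le P_{b,ub}^c=(P_b^D)^{Ws-\lfloor \frac{r_\ell(t)}{T/s}\rfloor}<(P_b^D)^{Ws-(r+1)},$$ and a simple lower bound $P_{b,lb}^c$ is given by $$P_{b,lb}^c=(P_b^D)^{Ws-\max(0,\;r_\ell(t)-(WT-Ws))},$$ which deviates from the best possible blocking probability $(P_b^D)^{Ws}$ only when $W=1$ and $T-s<r_\ell(t)<T$.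
   Context: **Storage layouts.** A file $\mathcal F=\{f_1,\dots,f_T\}$ of $T$ chunks is stored on $R=Ws$ drives, with $W$ and $s$ positive integers. In the uncoded $s$-striped system the $T$ chunks are partitioned into $s$ stripe sets of $T/s$ chunks each; each drive stores exactly one stripe set, and each stripe set is stored on exactly $W$ drives. In the coded system each of the $Ws$ drives stores $T/s$ coded chunks, for a total of $H=WT$ coded chunks $c_k=\sum_{j=1}^T\alpha_{j,k}f_j$ over a finite field. The code is MDS: any $T$ of the $H$ encoding vectors $(\alpha_{1,k},\dots,\alpha_{T,k})$ are linearly independent. **Service.** In each timeslot the server may read one chunk from one available (non-blocked) drive and broadcasts it without error to all active users. The knowledge space rank $r_m(t)$ of user $u_m$ is the rank of the matrix of encoding vectors it has received up to timeslot $t$ (an uncoded chunk $f_j$ has as encoding vector the $j$th unit vector of length $T$). A user is active while $r_m(t)<T$. The leader $u_\ell$ at timeslot $t$ is the active user with maximum rank $r_\ell(t)$. Under the leader-based scheduling considered, a leader of rank $r_\ell(t)$ has received exactly $r_\ell(t)$ distinct chunks. A drive is useful to the leader if it stores at least one chunk whose reception would increase the leader's rank. The internal blocking probability of the leader at timeslot $t$ is the probability that no useful drive is available in timeslot $t$, given the chunks the leader has already received. In the coded system it depends on how the $r_\ell(t)$ received chunks are distributed over the drives; the upper and lower bounds correspond to the worst and best such distributions.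
   Formalization: The strict inequality in (ii) is claimed only for P_b^D<1, as it fails when P_b^D=1; the final "deviates only when W=1" clause is claimed except when T=s with W≥2 and s≥2, where it fails, e.g. at rank 1. *)

theory Defs
  imports "HOL-Analysis.Analysis" "HOL-Probability.Probability"
begin

text \<open>The file has \<open>T = CARD('t)\<close> chunks, indexed by the finite type \<open>'t\<close>; \<open>'f\<close> is the
  coefficient field.  Stored chunks carry an index in \<open>'c\<close> and an encoding vector in \<open>'f ^ 't\<close>.
  Copies of one chunk on several drives share their index.\<close>

record ('d, 'c, 'f, 't) storage =
  drives :: "'d set"
  content :: "'d \<Rightarrow> 'c set"
  encv :: "'c \<Rightarrow> 'f ^ 't"

definition chunks :: "('d, 'c, 'f, 't::finite) storage \<Rightarrow> 'c set" where
  "chunks D = (\<Union>d\<in>drives D. content D d)"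

definition uncoded_striped ::
    "nat \<Rightarrow> nat \<Rightarrow> ('d, 't, 'f::field, 't::finite) storage \<Rightarrow> 't set set \<Rightarrow> bool" where
  "uncoded_striped W s D P \<longleftrightarrow>
     0 < W \<and> 0 < s \<and> s dvd CARD('t) \<and>
     finite (drives D) \<and> card (drives D) = W * s \<and>
     (\<forall>j. encv D j = axis j 1) \<and>
     partition_on UNIV P \<and> card P = s \<and> (\<forall>S\<in>P. card S = CARD('t) div s) \<and>
     (\<forall>d\<in>drives D. content D d \<in> P) \<and>
     (\<forall>S\<in>P. card {d \<in> drives D. content D d = S} = W)"

definition mds :: "('d, 'c, 'f::field, 't::finite) storage \<Rightarrow> bool" where
  "mds D \<longleftrightarrow>
     (\<forall>K \<subseteq> chunks D. card K = CARD('t) \<longrightarrow> inj_on (encv D) K \<and> vec.independent (encv D ` K))"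

definition coded_striped ::
    "nat \<Rightarrow> nat \<Rightarrow> ('d, nat, 'f::field, 't::finite) storage \<Rightarrow> bool" where
  "coded_striped W s D \<longleftrightarrow>
     0 < W \<and> 0 < s \<and> s dvd CARD('t) \<and>
     finite (drives D) \<and> card (drives D) = W * s \<and>
     disjoint_family_on (content D) (drives D) \<and>
     (\<forall>d\<in>drives D. card (content D d) = CARD('t) div s) \<and>
     chunks D = {..<W * CARD('t)} \<and>
     mds D"

text \<open>The rank of the matrix whose rows are the encoding vectors of the chunks in \<open>K\<close>;
  \<open>rank\<close> itself needs the set of rows to be indexed by a type.\<close>

definition krank :: "('d, 'c, 'f::field, 't::finite) storage \<Rightarrow> 'c set \<Rightarrow> nat" where
  "krank D K = vec.dim (encv D ` K)"

definition decoded :: "('d, 'c, 'f::field, 't::finite) storage \<Rightarrow> 'c set \<Rightarrow> 't set \<Rightarrow> bool" where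
  "decoded D K S \<longleftrightarrow> (\<forall>j\<in>S. axis j 1 \<in> vec.span (encv D ` K))"

definition useful :: "('d, 'c, 'f::field, 't::finite) storage \<Rightarrow> 'c set \<Rightarrow> 'd \<Rightarrow> bool" where
  "useful D K d \<longleftrightarrow> d \<in> drives D \<and> (\<exists>c\<in>content D d. krank D K < krank D (insert c K))"

text \<open>\<open>hist X n\<close> is the information available at the beginning of timeslot \<open>n\<close>;
  \<open>joins X u\<close> is the first timeslot in which user \<open>u\<close> listens to the broadcast;
  \<open>reads X n\<close> is the drive and the chunk read in timeslot \<open>n\<close>, if any.\<close>

record ('w, 'd, 'c, 'u) service =
  pspace :: "'w measure"
  hist :: "nat \<Rightarrow> 'w measure"
  blocked :: "nat \<Rightarrow> 'd \<Rightarrow> 'w \<Rightarrow> bool"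
  joins :: "'u \<Rightarrow> 'w \<Rightarrow> nat"
  reads :: "nat \<Rightarrow> 'w \<Rightarrow> ('d \<times> 'c) option"

text \<open>The chunks a user holds at the beginning of timeslot \<open>n\<close>, i.e. those broadcast in earlier
  timeslots in which the user was active.\<close>

primrec received ::
    "('d, 'c, 'f::field, 't::finite) storage \<Rightarrow> ('w, 'd, 'c, 'u) service \<Rightarrow> 'u \<Rightarrow> nat \<Rightarrow> 'w \<Rightarrow> 'c set"
where
  "received D X u 0 w = {}"
| "received D X u (Suc n) w =
     received D X u n w \<union>
     (if joins X u w \<le> n \<and> krank D (received D X u n w) < CARD('t)
      then {c. \<exists>d. reads X n w = Some (d, c)} else {})"

definition active ::
    "('d, 'c, 'f::field, 't::finite) storage \<Rightarrow> ('w, 'd, 'c, 'u) service \<Rightarrow> 'u \<Rightarrow> nat \<Rightarrow> 'w \<Rightarrow> bool" where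
  "active D X u n w \<longleftrightarrow> joins X u w \<le> n \<and> krank D (received D X u n w) < CARD('t)"

definition leader ::
    "('d, 'c, 'f::field, 't::finite) storage \<Rightarrow> ('w, 'd, 'c, 'u) service \<Rightarrow> 'u \<Rightarrow> nat \<Rightarrow> 'w \<Rightarrow> bool" where
  "leader D X u n w \<longleftrightarrow>
     active D X u n w \<and>
     (\<forall>v. active D X v n w \<longrightarrow> krank D (received D X v n w) \<le> krank D (received D X u n w))"

text \<open>The independence clause says that the blocking events of the drives in timeslot \<open>n\<close>
  are mutually independent and jointly independent of everything that happened before.\<close>

definition leader_based_service ::
    "real \<Rightarrow> ('d, 'c, 'f::field, 't::finite) storage \<Rightarrow> ('w, 'd, 'c, 'u::countable) service \<Rightarrow> bool" where
  "leader_based_service p D X \<longleftrightarrow>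
     prob_space (pspace X) \<and>
     filtration (space (pspace X)) (hist X) \<and>
     (\<forall>n. subalgebra (pspace X) (hist X n)) \<and>
     (\<forall>n. \<forall>d\<in>drives D. {w \<in> space (pspace X). blocked X n d w} \<in> sets (hist X (Suc n))) \<and>
     (\<forall>n x. {w \<in> space (pspace X). reads X n w = x} \<in> sets (hist X (Suc n))) \<and>
     (\<forall>n u. {w \<in> space (pspace X). joins X u w \<le> n} \<in> sets (hist X n)) \<and>
     (\<forall>n. \<forall>d\<in>drives D. \<P>(w in pspace X. blocked X n d w) = p) \<and>
     (\<forall>n. prob_space.indep_sets (pspace X)
        (case_option (sets (hist X n)) (\<lambda>d. {{w \<in> space (pspace X). blocked X n d w}}))
        (insert None (Some ` drives D))) \<and>
     (\<forall>n. \<forall>w\<in>space (pspace X). \<forall>d c. reads X n w = Some (d, c) \<longrightarrow>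
        d \<in> drives D \<and> c \<in> content D d \<and> \<not> blocked X n d w) \<and>
     (\<forall>n. \<forall>w\<in>space (pspace X). \<forall>u. leader D X u n w \<longrightarrow>
        card (received D X u n w) = krank D (received D X u n w))"

definition no_useful_available ::
    "('d, 'c, 'f::field, 't::finite) storage \<Rightarrow> ('w, 'd, 'c, 'u) service \<Rightarrow> nat \<Rightarrow> 'c set \<Rightarrow> 'w \<Rightarrow> bool" where
  "no_useful_available D X n K w \<longleftrightarrow> \<not> (\<exists>d\<in>drives D. useful D K d \<and> \<not> blocked X n d w)"

definition leader_holds ::
    "('d, 'c, 'f::field, 't::finite) storage \<Rightarrow> ('w, 'd, 'c, 'u) service \<Rightarrow> 'u \<Rightarrow> nat \<Rightarrow> 'c set \<Rightarrow> 'w \<Rightarrow> bool" where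
  "leader_holds D X u n K w \<longleftrightarrow> leader D X u n w \<and> received D X u n w = K"

definition internal_blocking_prob ::
    "('d, 'c, 'f::field, 't::finite) storage \<Rightarrow> ('w, 'd, 'c, 'u) service \<Rightarrow> 'u \<Rightarrow> nat \<Rightarrow> 'c set \<Rightarrow> real" where
  "internal_blocking_prob D X u n K =
     \<P>(w in pspace X. no_useful_available D X n (received D X u n w) w \<bar> leader_holds D X u n K w)"

text \<open>The blocking probability caused by a given set \<open>K\<close> of received chunks.  It is not conditioned
  on the leader actually holding \<open>K\<close>, so it also makes sense for sets that the given service process
  never produces; where \<open>internal_blocking_prob\<close> conditions on a non-null event, independence of
  the history makes the two agree.\<close>

definition blocking_prob ::
    "('d, 'c, 'f::field, 't::finite) storage \<Rightarrow> ('w, 'd, 'c, 'u) service \<Rightarrow> nat \<Rightarrow> 'c set \<Rightarrow> real" where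
  "blocking_prob D X n K = \<P>(w in pspace X. no_useful_available D X n K w)"

text \<open>Worst and best case over all distributions over the drives of the \<open>m\<close> chunks received by a
  leader of rank \<open>m\<close>.\<close>

definition worst_blocking_prob ::
    "('d, 'c, 'f::field, 't::finite) storage \<Rightarrow> ('w, 'd, 'c, 'u) service \<Rightarrow> nat \<Rightarrow> nat \<Rightarrow> real" where
  "worst_blocking_prob D X n m =
     Max {blocking_prob D X n K |K. K \<subseteq> chunks D \<and> card K = m \<and> krank D K = m}"

definition best_blocking_prob ::
    "('d, 'c, 'f::field, 't::finite) storage \<Rightarrow> ('w, 'd, 'c, 'u) service \<Rightarrow> nat \<Rightarrow> nat \<Rightarrow> real" where
  "best_blocking_prob D X n m =
     Min {blocking_prob D X n K |K. K \<subseteq> chunks D \<and> card K = m \<and> krank D K = m}"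

end

theory Submission
  imports Defs
begin

text \<open>Whether the leader holds exactly \<open>K\<close> at the beginning of a timeslot is determined by the
  history, hence independent of the current blocking events.  So its internal blocking probability
  is \<open>p\<close> to the number of drives that are useful given \<open>K\<close>.  An uncoded drive is useless exactly if
  its stripe set is decoded.  A coded drive is useless exactly if \<open>K\<close> contains its whole content,
  because the MDS property makes rank and cardinality agree for up to \<open>T\<close> chunks.  The number of
  drives contained in \<open>K\<close> is at most \<open>\<lfloor>card K / (T/s)\<rfloor>\<close>, attained by filling up drives one after the
  other, and at least \<open>card K - (W T - W s)\<close>, attained by first avoiding one chunk of every drive.\<close>

section \<open>Measurability of the holdings and of leadership with respect to the history\<close>

lemma received_subset_chunks:
  assumes X: "leader_based_service p D X" and w: "w \<in> space (pspace X)"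
  shows "received D X u n w \<subseteq> chunks D"
proof (induction n)
  case 0
  show ?case by simp
next
  case (Suc n)
  have "d \<in> drives D \<and> c \<in> content D d" if "reads X n w = Some (d, c)" for d c
    using X w that unfolding leader_based_service_def by blast
  hence "{c. \<exists>d. reads X n w = Some (d, c)} \<subseteq> chunks D"
    unfolding chunks_def by blast
  with Suc show ?case by auto
qed

lemma space_hist:
  assumes "leader_based_service p D X"
  shows "space (hist X n) = space (pspace X)"
  using assms unfolding leader_based_service_def subalgebra_def by blast

lemma sets_hist_Suc:
  assumes "leader_based_service p D X"
  shows "sets (hist X n) \<subseteq> sets (hist X (Suc n))"
proof -
  have "filtration (space (pspace X)) (hist X)"
    using assms unfolding leader_based_service_def by blast
  thus ?thesis
    using filtration.sets_F_mono[of "space (pspace X)" "hist X" n "Suc n"] by simp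
qed

text \<open>What a user holds at the beginning of a timeslot is a function of earlier reads and join
  times, all recorded in the history. Only finitely many holdings are possible, so an arbitrary
  predicate \<open>Q\<close> causes no measurability problem; its generality lets the induction
  hypothesis be applied to the event of holding one fixed set.\<close>

lemma sets_received:
  fixes D :: "('d, 'c, 'f::field, 't::finite) storage"
  assumes X: "leader_based_service p D X"
    and fin: "finite (drives D)" "\<And>d. d \<in> drives D \<Longrightarrow> finite (content D d)"
  shows "{w \<in> space (pspace X). Q (received D X u n w)} \<in> sets (hist X n)"
proof (induction n arbitrary: Q)
  case 0
  have "{w \<in> space (pspace X). Q {}} = (if Q {} then space (hist X 0) else {})"
    using space_hist[OF X] by auto
  thus ?case by simp
next
  case (Suc n)
  let ?S = "space (pspace X)"
  let ?R = "insert None (Some ` Sigma (drives D) (content D))"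
  let ?new = "\<lambda>K x b. K \<union> (if b \<and> krank D K < CARD('t) then {c. \<exists>d. x = Some (d, c)} else {})"
  have finC: "finite (chunks D)"
    using fin unfolding chunks_def by blast
  have finR: "finite ?R"
    using fin by simp
  have rd: "reads X n w \<in> ?R" if "w \<in> ?S" for w
  proof (cases "reads X n w")
    case (Some a)
    obtain d c where "a = (d, c)" by (cases a)
    with Some X that have "d \<in> drives D \<and> c \<in> content D d"
      unfolding leader_based_service_def by blast
    with Some \<open>a = (d, c)\<close> show ?thesis by simp
  qed simp
  \<comment> \<open>The event is split by the finitely many values of the old holdings, the read and
    the joining flag. On each piece the update \<open>?new\<close> is constant, so \<open>Q\<close>
    merely selects which pieces occur in the union.\<close>
  have eq: "{w \<in> ?S. Q (received D X u (Suc n) w)} =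
      (\<Union>K\<in>Pow (chunks D). \<Union>x\<in>?R. \<Union>b\<in>{b. Q (?new K x b)}.
        {w \<in> ?S. received D X u n w = K} \<inter> {w \<in> ?S. reads X n w = x} \<inter>
        {w \<in> ?S. (joins X u w \<le> n) = b})" (is "?L = ?U")
  proof
    show "?L \<subseteq> ?U"
    proof
      fix w assume w: "w \<in> ?L"
      hence "received D X u n w \<in> Pow (chunks D)" "reads X n w \<in> ?R"
        "Q (?new (received D X u n w) (reads X n w) (joins X u w \<le> n))"
        using received_subset_chunks[OF X] rd by auto
      with w show "w \<in> ?U" by blast
    qed
    show "?U \<subseteq> ?L" by auto
  qed
  have "{w \<in> ?S. received D X u n w = K} \<in> sets (hist X (Suc n))" for K
    using Suc[of "\<lambda>L. L = K"] sets_hist_Suc[OF X] by blast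
  moreover have "{w \<in> ?S. reads X n w = x} \<in> sets (hist X (Suc n))" for x
    using X unfolding leader_based_service_def by blast
  moreover have "{w \<in> ?S. (joins X u w \<le> n) = b} \<in> sets (hist X (Suc n))" for b
  proof -
    have *: "{w \<in> ?S. joins X u w \<le> n} \<in> sets (hist X (Suc n))"
      using X sets_hist_Suc[OF X, of n] unfolding leader_based_service_def by blast
    hence "?S - {w \<in> ?S. joins X u w \<le> n} \<in> sets (hist X (Suc n))"
      using space_hist[OF X, of "Suc n"] sets.compl_sets[OF *] by simp
    moreover have "?S - {w \<in> ?S. joins X u w \<le> n} = {w \<in> ?S. (joins X u w \<le> n) = False}"
      by auto
    ultimately show ?thesis using * by (cases b) auto
  qed
  ultimately show ?case
    unfolding eq using finC finR by (intro sets.finite_UN sets.Int) auto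
qed

text \<open>Leadership compares one user with all others. As the user type is countable, this is a
  countable intersection of events in the history.\<close>

lemma sets_leader_holds:
  fixes X :: "('w, 'd, 'c, 'u::countable) service"
  assumes X: "leader_based_service p D X"
    and fin: "finite (drives D)" "\<And>d. d \<in> drives D \<Longrightarrow> finite (content D d)"
  shows "{w \<in> space (pspace X). leader_holds D X u n K w} \<in> sets (hist X n)"
proof -
  let ?S = "space (pspace X)"
  note sets_received[OF X fin, where n = n, unfolded space_hist[OF X, of n, symmetric], measurable]
  have [measurable]: "{w \<in> space (hist X n). joins X v w \<le> n} \<in> sets (hist X n)" for v
    using X space_hist[OF X] unfolding leader_based_service_def by simp
  \<comment> \<open>On this event the rank of the leader equals \<open>krank D K\<close>, so every
    other user is compared with a constant.\<close>
  have "{w \<in> space (hist X n). (active D X u n w \<and>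
      (\<forall>v. active D X v n w \<longrightarrow> krank D (received D X v n w) \<le> krank D K)) \<and>
      received D X u n w = K} \<in> sets (hist X n)"
    unfolding active_def by measurable
  also have "{w \<in> space (hist X n). (active D X u n w \<and>
      (\<forall>v. active D X v n w \<longrightarrow> krank D (received D X v n w) \<le> krank D K)) \<and>
      received D X u n w = K} = {w \<in> ?S. leader_holds D X u n K w}"
    unfolding leader_holds_def leader_def space_hist[OF X] by auto
  finally show ?thesis .
qed

section \<open>Blocking probabilities as powers of \<open>p\<close>\<close>

lemma prob_no_useful_available:
  assumes X: "leader_based_service p D X" and fin: "finite (drives D)"
    and A: "A \<in> sets (hist X n)"
  shows "measure (pspace X) ({w \<in> space (pspace X). no_useful_available D X n K w} \<inter> A) =
    measure (pspace X) A * p ^ card {d. useful D K d}"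
proof -
  let ?S = "space (pspace X)" and ?V = "{d. useful D K d}"
  \<comment> \<open>Index \<open>None\<close> carries the past event and \<open>Some d\<close> the
    blocking event of drive \<open>d\<close>, so one product formula covers both. Because
    \<open>None\<close> is always present, the index set is nonempty even when no drive is
    useful.\<close>
  let ?A = "case_option A (\<lambda>d. {w \<in> ?S. blocked X n d w})"
  interpret prob_space "pspace X"
    using X unfolding leader_based_service_def by blast
  have V: "?V \<subseteq> drives D" unfolding useful_def by blast
  hence finV: "finite ?V" using fin finite_subset by blast
  have ind: "indep_sets (case_option (sets (hist X n)) (\<lambda>d. {{w \<in> ?S. blocked X n d w}}))
      (insert None (Some ` drives D))"
    using X unfolding leader_based_service_def by blast
  have "prob (\<Inter>j\<in>insert None (Some ` ?V). ?A j) = (\<Prod>j\<in>insert None (Some ` ?V). prob (?A j))"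
    by (rule indep_setsD[OF ind]) (use V finV A in auto)
  moreover have "(\<Inter>j\<in>insert None (Some ` ?V). ?A j) =
      {w \<in> ?S. no_useful_available D X n K w} \<inter> A"
    using V sets.sets_into_space[OF A] space_hist[OF X, of n]
    unfolding no_useful_available_def by auto
  moreover have "(\<Prod>j\<in>insert None (Some ` ?V). prob (?A j)) = prob A * (\<Prod>d\<in>?V. p)"
  proof -
    have "prob {w \<in> ?S. blocked X n d w} = p" if "d \<in> ?V" for d
      using X V that unfolding leader_based_service_def by blast
    thus ?thesis
      using finV by (subst prod.insert) (auto simp: prod.reindex)
  qed
  ultimately show ?thesis by simp
qed

text \<open>This is the product formula with the whole space as past event.\<close>

lemma blocking_prob_eq:
  assumes X: "leader_based_service p D X" and fin: "finite (drives D)"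
  shows "blocking_prob D X n K = p ^ card {d. useful D K d}"
proof -
  interpret prob_space "pspace X"
    using X unfolding leader_based_service_def by blast
  have "space (pspace X) \<in> sets (hist X n)"
    using sets.top[of "hist X n"] space_hist[OF X] by simp
  from prob_no_useful_available[OF X fin this, of K] show ?thesis
    unfolding blocking_prob_def by (simp add: prob_space Int_absorb2)
qed

text \<open>The conditioning event lies in the history, so its probability splits off as a factor
  and cancels in the quotient; \<open>pos\<close> makes the division legitimate.\<close>

lemma internal_blocking_prob_eq:
  fixes X :: "('w, 'd, 'c, 'u::countable) service"
  assumes X: "leader_based_service p D X"
    and fin: "finite (drives D)" "\<And>d. d \<in> drives D \<Longrightarrow> finite (content D d)"
    and pos: "0 < \<P>(w in pspace X. leader_holds D X u n K w)"
  shows "internal_blocking_prob D X u n K = p ^ card {d. useful D K d}"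
proof -
  let ?S = "space (pspace X)" and ?A = "{w \<in> space (pspace X). leader_holds D X u n K w}"
  have "{w \<in> ?S. no_useful_available D X n (received D X u n w) w \<and> leader_holds D X u n K w} =
      {w \<in> ?S. no_useful_available D X n K w} \<inter> ?A"
    unfolding leader_holds_def by auto
  moreover have "?A \<in> sets (hist X n)" by (rule sets_leader_holds[OF X fin])
  ultimately show ?thesis
    using prob_no_useful_available[OF X fin(1), of ?A n K] pos
    unfolding internal_blocking_prob_def cond_prob_def by simp
qed

text \<open>An event of positive probability contains an outcome, and the facts about
  \<open>K\<close> can be read off at that single outcome.\<close>

lemma leader_holds_chunks:
  assumes X: "leader_based_service p D X"
    and pos: "0 < \<P>(w in pspace X. leader_holds D X u n K w)"
  shows "K \<subseteq> chunks D \<and> card K = krank D K"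
proof -
  have "{w \<in> space (pspace X). leader_holds D X u n K w} \<noteq> {}"
    using pos by (metis less_irrefl measure_empty)
  then obtain w where w: "w \<in> space (pspace X)" "leader D X u n w" "received D X u n w = K"
    unfolding leader_holds_def by blast
  moreover from w X have "card (received D X u n w) = krank D (received D X u n w)"
    unfolding leader_based_service_def by blast
  ultimately show ?thesis using received_subset_chunks[OF X] by blast
qed

text \<open>\<open>p\<close> is the probability of an actual blocking event as soon as there is a
  drive. The bound makes powers of \<open>p\<close> antitone in the exponent.\<close>

lemma blocking_parameter_le_1:
  assumes X: "leader_based_service p D X" and "drives D \<noteq> {}"
  shows "p \<le> 1"
proof -
  interpret prob_space "pspace X"
    using X unfolding leader_based_service_def by blast
  obtain d where "d \<in> drives D" using assms by blast
  hence "\<P>(w in pspace X. blocked X 0 d w) = p"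
    using X unfolding leader_based_service_def by blast
  thus ?thesis using prob_le_1 by metis
qed

section \<open>Useful drives in the two layouts\<close>

lemma krank_insert:
  "krank D (insert c K) = (if encv D c \<in> vec.span (encv D ` K) then krank D K else Suc (krank D K))"
  unfolding krank_def by (simp add: vec.dim_insert)

lemma useful_uncoded_iff:
  assumes "uncoded_striped W s D P"
  shows "useful D K d \<longleftrightarrow> d \<in> drives D \<and> \<not> decoded D K (content D d)"
proof -
  have "encv D = (\<lambda>j. axis j 1)" using assms unfolding uncoded_striped_def by auto
  thus ?thesis unfolding useful_def decoded_def krank_insert by auto
qed

text \<open>Useful drives are grouped by stripe set: each undecoded set contributes its
  \<open>W\<close> copies, and different sets contribute disjoint groups.\<close>

lemma card_useful_uncoded:
  assumes D: "uncoded_striped W s D P"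
  shows "card {d. useful D K d} = W * (s - card {S \<in> P. decoded D K S})"
proof -
  let ?Q = "{S \<in> P. \<not> decoded D K S}"
  have P: "finite P" "card P = s"
    using D unfolding uncoded_striped_def by (auto intro: card_ge_0_finite)
  have "{d. useful D K d} = (\<Union>S\<in>?Q. {d \<in> drives D. content D d = S})"
    using D unfolding useful_uncoded_iff[OF D] uncoded_striped_def by auto
  also have "card \<dots> = (\<Sum>S\<in>?Q. card {d \<in> drives D. content D d = S})"
    by (rule card_UN_disjoint) (use D P in \<open>auto simp: uncoded_striped_def\<close>)
  also have "\<dots> = (\<Sum>S\<in>?Q. W)"
    using D unfolding uncoded_striped_def by (intro sum.cong) auto
  also have "\<dots> = W * card ?Q" by simp
  also have "?Q = P - {S \<in> P. decoded D K S}" by blast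
  also have "card \<dots> = s - card {S \<in> P. decoded D K S}"
    using P by (subst card_Diff_subset) auto
  finally show ?thesis .
qed

text \<open>The MDS condition speaks of sets of exactly \<open>CARD('t)\<close> chunks. A smaller
  \<open>K\<close> is extended to such a set and inherits independence and injectivity; the latter
  ensures that passing to the image of \<open>encv D\<close> does not lose chunks.\<close>

lemma krank_mds:
  fixes D :: "('d, 'c, 'f::field, 't::finite) storage"
  assumes "mds D" "finite (chunks D)" "CARD('t) \<le> card (chunks D)"
    and K: "K \<subseteq> chunks D" "card K \<le> CARD('t)"
  shows "krank D K = card K"
proof -
  obtain L where L: "K \<subseteq> L" "L \<subseteq> chunks D" "card L = CARD('t)"
    using exists_subset_between[OF K(2) assms(3) K(1) assms(2)] by blast
  hence "inj_on (encv D) L" "vec.independent (encv D ` L)"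
    using assms(1) unfolding mds_def by blast+
  hence "inj_on (encv D) K" "vec.independent (encv D ` K)"
    using inj_on_subset[OF _ L(1)] vec.independent_mono[OF _ image_mono[OF L(1)]] by simp_all
  thus ?thesis
    unfolding krank_def by (simp add: vec.dim_eq_card_independent card_image)
qed

text \<open>The strict bound on \<open>card K\<close> leaves room for one more chunk, so rank equals
  cardinality both before and after an insertion.\<close>

lemma useful_mds_iff:
  fixes D :: "('d, 'c, 'f::field, 't::finite) storage"
  assumes D: "mds D" "finite (chunks D)" "CARD('t) \<le> card (chunks D)"
    and K: "K \<subseteq> chunks D" "card K < CARD('t)"
  shows "useful D K d \<longleftrightarrow> d \<in> drives D \<and> \<not> content D d \<subseteq> K"
proof -
  have "krank D K < krank D (insert c K) \<longleftrightarrow> c \<notin> K" if "d \<in> drives D" "c \<in> content D d" for c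
  proof (cases "c \<in> K")
    case True
    thus ?thesis by (simp add: insert_absorb)
  next
    case False
    have "insert c K \<subseteq> chunks D" using K that unfolding chunks_def by blast
    moreover have "card (insert c K) = Suc (card K)"
      using False K(1) D(2) by (meson card_insert_disjoint finite_subset)
    ultimately show ?thesis
      using False K krank_mds[OF D, of K] krank_mds[OF D, of "insert c K"] by simp
  qed
  thus ?thesis unfolding useful_def by blast
qed

section \<open>Counting disjoint blocks contained in a set\<close>

lemma card_contained_le:
  assumes "finite I" "disjoint_family_on A I" "\<And>i. i \<in> I \<Longrightarrow> card (A i) = q" "0 < q" "finite K"
  shows "card {i \<in> I. A i \<subseteq> K} \<le> card K div q"
proof -
  let ?F = "{i \<in> I. A i \<subseteq> K}"
  have "card (\<Union>i\<in>?F. A i) = (\<Sum>i\<in>?F. card (A i))"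
    using assms by (intro card_UN_disjoint)
      (auto simp: disjoint_family_on_def intro: card_ge_0_finite)
  also have "\<dots> = card ?F * q" using assms(3) by simp
  finally have "card ?F * q = card (\<Union>i\<in>?F. A i)" by simp
  also have "\<dots> \<le> card K" using assms(5) by (intro card_mono) auto
  finally show ?thesis using assms(4) by (simp add: less_eq_div_iff_mult_less_eq)
qed

text \<open>Each block not contained in \<open>K\<close> has an element outside \<open>K\<close>. By
  disjointness these elements differ, so there are at most as many such blocks as elements missing
  from \<open>K\<close>.\<close>

lemma card_contained_ge:
  assumes "finite I" "disjoint_family_on A I" "finite (\<Union>i\<in>I. A i)" "K \<subseteq> (\<Union>i\<in>I. A i)"
  shows "card I - (card (\<Union>i\<in>I. A i) - card K) \<le> card {i \<in> I. A i \<subseteq> K}"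
proof -
  let ?J = "{i \<in> I. \<not> A i \<subseteq> K}"
  have "\<exists>f. \<forall>i\<in>?J. f i \<in> A i - K" by (intro bchoice) blast
  then obtain f where f: "\<And>i. i \<in> ?J \<Longrightarrow> f i \<in> A i - K" by blast
  have "inj_on f ?J"
  proof (rule inj_onI)
    fix i j assume "i \<in> ?J" "j \<in> ?J" "f i = f j"
    hence "f i \<in> A i \<inter> A j" using f by fastforce
    with \<open>i \<in> ?J\<close> \<open>j \<in> ?J\<close> show "i = j"
      using disjoint_family_onD[OF assms(2), of i j] by auto
  qed
  hence "card ?J \<le> card ((\<Union>i\<in>I. A i) - K)"
    using f assms(3) by (intro card_inj_on_le) auto
  also have "\<dots> = card (\<Union>i\<in>I. A i) - card K"
    using assms(3,4) by (meson card_Diff_subset finite_subset)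
  finally have "card ?J \<le> card (\<Union>i\<in>I. A i) - card K" .
  moreover have "card I = card {i \<in> I. A i \<subseteq> K} + card ?J"
    using assms(1) by (subst card_Un_disjoint[symmetric]) (auto intro: arg_cong[where f = card])
  ultimately show ?thesis by linarith
qed

text \<open>The worst distribution: \<open>k\<close> whole blocks are taken first and then extended
  arbitrarily to size \<open>m\<close>.\<close>

lemma ex_card_contained_ge:
  assumes "finite I" "disjoint_family_on A I" "\<And>i. i \<in> I \<Longrightarrow> card (A i) = q" "0 < q"
    and m: "m \<le> card (\<Union>i\<in>I. A i)" and k: "k \<le> card I" "k * q \<le> m"
  shows "\<exists>K \<subseteq> (\<Union>i\<in>I. A i). card K = m \<and> k \<le> card {i \<in> I. A i \<subseteq> K}"
proof -
  have finA: "finite (A i)" if "i \<in> I" for i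
    using assms(3)[OF that] assms(4) by (intro card_ge_0_finite) simp
  obtain J where J: "J \<subseteq> I" "card J = k"
    using obtain_subset_with_card_n[OF k(1)] by blast
  have "card (\<Union>i\<in>J. A i) = (\<Sum>i\<in>J. card (A i))"
    using assms(1,2) J finA by (intro card_UN_disjoint)
      (auto simp: disjoint_family_on_def intro: finite_subset)
  also have "\<dots> = (\<Sum>i\<in>J. q)" using J assms(3) by (intro sum.cong) auto
  also have "\<dots> = k * q" using J by simp
  finally have cJ: "card (\<Union>i\<in>J. A i) \<le> m" using k by simp
  obtain K where K: "(\<Union>i\<in>J. A i) \<subseteq> K" "K \<subseteq> (\<Union>i\<in>I. A i)" "card K = m"
    using exists_subset_between[OF cJ m] J finA assms(1) by blast
  have "card J \<le> card {i \<in> I. A i \<subseteq> K}"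
    using assms(1) J K by (intro card_mono) auto
  with J K show ?thesis by blast
qed

text \<open>The best distribution: one representative of every block is avoided for as long as
  possible. A contained block must contribute its representative, so the representatives in
  \<open>K\<close> bound the number of contained blocks.\<close>

lemma ex_card_contained_le:
  assumes "finite I" "disjoint_family_on A I" "\<And>i. i \<in> I \<Longrightarrow> A i \<noteq> {}"
    and fin: "finite (\<Union>i\<in>I. A i)" and m: "m \<le> card (\<Union>i\<in>I. A i)"
  shows "\<exists>K \<subseteq> (\<Union>i\<in>I. A i). card K = m \<and>
    card {i \<in> I. A i \<subseteq> K} \<le> m - (card (\<Union>i\<in>I. A i) - card I)"
proof -
  let ?U = "\<Union>i\<in>I. A i"
  have "\<exists>f. \<forall>i\<in>I. f i \<in> A i" using assms(3) by (intro bchoice) blast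
  then obtain f where f: "\<And>i. i \<in> I \<Longrightarrow> f i \<in> A i" by blast
  have inj: "inj_on f I"
  proof (rule inj_onI)
    fix i j assume "i \<in> I" "j \<in> I" "f i = f j"
    hence "f i \<in> A i \<inter> A j" using f by fastforce
    with \<open>i \<in> I\<close> \<open>j \<in> I\<close> show "i = j"
      using disjoint_family_onD[OF assms(2), of i j] by auto
  qed
  have fU: "f ` I \<subseteq> ?U" using f by blast
  have cD: "card (?U - f ` I) = card ?U - card I"
    using fU fin inj assms(1) by (subst card_Diff_subset) (auto simp: card_image)
  have contained: "card {i \<in> I. A i \<subseteq> K} \<le> card (K \<inter> f ` I)" if "K \<subseteq> ?U" for K
  proof (rule card_inj_on_le[of f])
    show "inj_on f {i \<in> I. A i \<subseteq> K}" using inj by (rule inj_on_subset) blast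
    show "f ` {i \<in> I. A i \<subseteq> K} \<subseteq> K \<inter> f ` I" using f by blast
    show "finite (K \<inter> f ` I)" using assms(1) by simp
  qed
  show ?thesis
  proof (cases "m \<le> card (?U - f ` I)")
    case True
    then obtain K where K: "K \<subseteq> ?U - f ` I" "card K = m"
      using obtain_subset_with_card_n by blast
    hence "K \<inter> f ` I = {}" "K \<subseteq> ?U" by auto
    with contained[of K] K(2) show ?thesis by auto
  next
    \<comment> \<open>All non-representatives are used up, and only the excess of \<open>m\<close>
      over their number has to be taken from the representatives.\<close>
    case False
    then obtain K where K: "?U - f ` I \<subseteq> K" "K \<subseteq> ?U" "card K = m"
      using exists_subset_between[of "?U - f ` I" m ?U] m fin by auto
    have "K \<inter> f ` I = K - (?U - f ` I)" using K by blast
    also have "card \<dots> = m - (card ?U - card I)"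
      using K fin cD by (subst card_Diff_subset) (auto intro: finite_subset)
    finally show ?thesis using contained[OF K(2)] K by auto
  qed
qed

section \<open>Extremal blocking probabilities of the coded system\<close>

lemma card_content_union_coded:
  fixes D :: "('d, nat, 'f::field, 't::finite) storage"
  assumes "coded_striped W s D"
  shows "card (\<Union>d\<in>drives D. content D d) = W * CARD('t)"
    "finite (\<Union>d\<in>drives D. content D d)"
proof -
  have "(\<Union>d\<in>drives D. content D d) = {..<W * CARD('t)}"
    using assms unfolding coded_striped_def chunks_def by blast
  thus "card (\<Union>d\<in>drives D. content D d) = W * CARD('t)"
    "finite (\<Union>d\<in>drives D. content D d)" by simp_all
qed

lemma blocking_prob_coded:
  fixes D :: "('d, nat, 'f::field, 't::finite) storage"
  assumes D: "coded_striped W s D" and X: "leader_based_service p D X"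
    and K: "K \<subseteq> chunks D" "card K < CARD('t)"
  shows "krank D K = card K"
    "blocking_prob D X n K = p ^ (W * s - card {d \<in> drives D. content D d \<subseteq> K})"
proof -
  have *: "mds D" "finite (chunks D)" "CARD('t) \<le> card (chunks D)"
    and fin: "finite (drives D)" and "card (drives D) = W * s"
    using D unfolding coded_striped_def by auto
  show "krank D K = card K" using krank_mds[OF * K(1)] K(2) by simp
  have "{d. useful D K d} = drives D - {d \<in> drives D. content D d \<subseteq> K}"
    using useful_mds_iff[OF * K] by blast
  hence "card {d. useful D K d} = W * s - card {d \<in> drives D. content D d \<subseteq> K}"
    using fin \<open>card (drives D) = W * s\<close> by (simp add: card_Diff_subset)
  thus "blocking_prob D X n K = p ^ (W * s - card {d \<in> drives D. content D d \<subseteq> K})"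
    using blocking_prob_eq[OF X fin] by simp
qed

text \<open>Since \<open>0 < p\<close> and \<open>p \<le> 1\<close>, more exhausted drives mean a
  larger blocking probability. \<open>Max\<close> and \<open>Min\<close> thus reduce to the largest
  and smallest number of drives contained in an \<open>m\<close>-element \<open>K\<close>, each
  found by a counting bound and a set attaining it.\<close>

lemma extremal_blocking_prob_coded:
  fixes D :: "('d, nat, 'f::field, 't::finite) storage"
  assumes D: "coded_striped W s D" and X: "leader_based_service p D X"
    and p: "0 < p" and m: "m < CARD('t)"
  shows "finite {blocking_prob D X n K |K. K \<subseteq> chunks D \<and> card K = m \<and> krank D K = m}"
    and "worst_blocking_prob D X n m = p ^ (W * s - m div (CARD('t) div s))"
    and "best_blocking_prob D X n m = p ^ (W * s - (m - (W * CARD('t) - W * s)))"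
proof -
  let ?q = "CARD('t) div s" and ?F = "\<lambda>K. card {d \<in> drives D. content D d \<subseteq> K}"
  let ?B = "{blocking_prob D X n K |K. K \<subseteq> chunks D \<and> card K = m \<and> krank D K = m}"
  have Ws: "0 < W" "0 < s" "s dvd CARD('t)" and fin: "finite (drives D)"
    and cD: "card (drives D) = W * s" and dis: "disjoint_family_on (content D) (drives D)"
    and cc: "\<And>d. d \<in> drives D \<Longrightarrow> card (content D d) = ?q"
    and ch: "chunks D = {..<W * CARD('t)}"
    using D unfolding coded_striped_def by auto
  have q: "0 < ?q" using Ws by (simp add: dvd_imp_le div_greater_zero_iff)
  have U: "(\<Union>d\<in>drives D. content D d) = chunks D" unfolding chunks_def ..
  note cU = card_content_union_coded[OF D]
  have sWs: "s \<le> W * s" using Ws(1) by simp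
  have sT: "s \<le> CARD('t)" using Ws by (simp add: dvd_imp_le)
  have mU: "m \<le> card (\<Union>d\<in>drives D. content D d)"
  proof -
    have "1 * CARD('t) \<le> W * CARD('t)" using Ws(1) by (intro mult_le_mono1) simp
    thus ?thesis using m cU(1) by linarith
  qed
  have p1: "p \<le> 1"
    using blocking_parameter_le_1[OF X] cD Ws by (metis card.empty mult_is_0 not_gr0)
  \<comment> \<open>For \<open>m < CARD('t)\<close> the MDS property gives every
    \<open>m\<close>-element set of chunks rank \<open>m\<close>, so \<open>?B\<close> is an image
    over all those sets.\<close>
  have B: "?B = (\<lambda>K. p ^ (W * s - ?F K)) ` {K. K \<subseteq> chunks D \<and> card K = m}"
  proof -
    have *: "krank D K = m" "blocking_prob D X n K = p ^ (W * s - ?F K)"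
      if "K \<subseteq> chunks D" "card K = m" for K
    proof -
      have "card K < CARD('t)" using that(2) m by (rule ssubst)
      note K = blocking_prob_coded[OF D X that(1) this]
      show "krank D K = m" using K(1) that(2) by (rule trans)
      show "blocking_prob D X n K = p ^ (W * s - ?F K)" by (rule K(2))
    qed
    have "(K \<subseteq> chunks D \<and> card K = m \<and> krank D K = m) \<longleftrightarrow> (K \<subseteq> chunks D \<and> card K = m)" for K
      using *(1)[of K] by argo
    hence "?B = blocking_prob D X n ` {K. K \<subseteq> chunks D \<and> card K = m}"
      by (simp only: setcompr_eq_image)
    also have "\<dots> = (\<lambda>K. p ^ (W * s - ?F K)) ` {K. K \<subseteq> chunks D \<and> card K = m}"
      using *(2) by (intro image_cong) simp_all
    finally show ?thesis .
  qed
  show finB: "finite ?B" unfolding B ch by simp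
  have le1: "?F K \<le> m div ?q" if K: "K \<subseteq> chunks D" "card K = m" for K
  proof -
    have "finite K" using finite_subset[OF K(1)] ch by simp
    thus ?thesis using card_contained_le[OF fin dis cc q, of K] K(2) by simp
  qed
  \<comment> \<open>The two truncated differences \<open>W * s - (W * CARD('t) - m)\<close> and
    \<open>m - (W * CARD('t) - W * s)\<close> agree because both \<open>m\<close> and
    \<open>W * s\<close> are at most \<open>W * CARD('t)\<close>.\<close>
  have le2: "m - (W * CARD('t) - W * s) \<le> ?F K" if K: "K \<subseteq> chunks D" "card K = m" for K
  proof -
    have "W * s \<le> W * CARD('t)" using sT by simp
    moreover have "card (drives D) - (card (\<Union>d\<in>drives D. content D d) - card K) \<le> ?F K"
    proof (rule card_contained_ge)
      show "K \<subseteq> (\<Union>d\<in>drives D. content D d)" using K(1) unfolding U .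
    qed (fact fin dis cU(2))+
    hence "W * s - (W * CARD('t) - m) \<le> ?F K" unfolding cU(1) cD K(2) .
    ultimately show ?thesis using mU cU(1) by linarith
  qed
  show "worst_blocking_prob D X n m = p ^ (W * s - m div ?q)"
    unfolding worst_blocking_prob_def
  proof (rule Max_eqI[OF finB])
    fix y assume "y \<in> ?B"
    thus "y \<le> p ^ (W * s - m div ?q)"
      using le1 p p1 unfolding B by (auto intro!: power_decreasing diff_le_mono2)
  next
    \<comment> \<open>There are enough drives to fill \<open>m div ?q\<close> of them completely, as
      this quotient is at most \<open>s\<close>.\<close>
    have "m < s * ?q" using m Ws(3) by simp
    hence "m div ?q \<le> s" by (simp add: less_mult_imp_div_less less_imp_le)
    hence "m div ?q \<le> card (drives D)"
      unfolding cD using sWs by (rule order_trans)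
    then obtain K where K: "K \<subseteq> chunks D" "card K = m" "m div ?q \<le> ?F K"
      using ex_card_contained_ge[OF fin dis cc q mU, of "m div ?q"] U by auto
    hence "?F K = m div ?q" using le1[OF K(1,2)] by linarith
    hence "p ^ (W * s - m div ?q) = p ^ (W * s - ?F K)" by simp
    with K show "p ^ (W * s - m div ?q) \<in> ?B"
      unfolding B by blast
  qed
  show "best_blocking_prob D X n m = p ^ (W * s - (m - (W * CARD('t) - W * s)))"
    unfolding best_blocking_prob_def
  proof (rule Min_eqI[OF finB])
    fix y assume "y \<in> ?B"
    thus "p ^ (W * s - (m - (W * CARD('t) - W * s))) \<le> y"
      using le2 p p1 unfolding B by (auto intro!: power_decreasing diff_le_mono2)
  next
    have "content D d \<noteq> {}" if "d \<in> drives D" for d using cc[OF that] q by auto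
    then obtain K where K: "K \<subseteq> chunks D" "card K = m" "?F K \<le> m - (W * CARD('t) - W * s)"
      using ex_card_contained_le[OF fin dis _ cU(2) mU] cU(1) cD U by metis
    hence "?F K = m - (W * CARD('t) - W * s)" using le2[OF K(1,2)] by linarith
    hence "p ^ (W * s - (m - (W * CARD('t) - W * s))) = p ^ (W * s - ?F K)" by simp
    with K show "p ^ (W * s - (m - (W * CARD('t) - W * s))) \<in> ?B"
      unfolding B by blast
  qed
qed

section \<open>Internal blocking probabilities and their bounds\<close>

theorem lemma7:
  fixes W s T r rl t :: nat and p :: real
    and U :: "('d, 't::finite, 'f::{field,finite}, 't) storage"
    and P :: "'t set set"
    and C :: "('e, nat, 'f, 't) storage"
    and X :: "('w, 'd, 't, 'u::countable) service"
    and Y :: "('v, 'e, nat, 'x::countable) service"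
  assumes T: "T = CARD('t)"
    and uncoded: "uncoded_striped W s U P"
    and coded: "coded_striped W s C"
    and p_pos: "0 < p"
    and service_U: "leader_based_service p U X"
    and service_C: "leader_based_service p C Y"
    and r: "r \<in> {0..s - 1}"
    and rl: "real r * (real T / real s) \<le> real rl" "real rl < real (r + 1) * (real T / real s)"
  shows
    "(\<forall>u K. 0 < \<P>(w in pspace X. leader_holds U X u t K w) \<and> krank U K = rl \<and>
        card {S \<in> P. decoded U K S} = r \<longrightarrow>
        internal_blocking_prob U X u t K = p powi (int (W * s) - int (W * r))) \<and>
     (\<forall>u K. 0 < \<P>(w in pspace Y. leader_holds C Y u t K w) \<and> krank C K = rl \<longrightarrow>
        best_blocking_prob C Y t rl \<le> internal_blocking_prob C Y u t K \<and>
        internal_blocking_prob C Y u t K \<le> worst_blocking_prob C Y t rl) \<and>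
     p powi (int (W * s) - int r) \<le> worst_blocking_prob C Y t rl \<and>
     worst_blocking_prob C Y t rl = p powi (int (W * s) - \<lfloor>real rl / (real T / real s)\<rfloor>) \<and>
     (p < 1 \<longrightarrow> worst_blocking_prob C Y t rl < p powi (int (W * s) - int (r + 1))) \<and>
     best_blocking_prob C Y t rl =
       p powi (int (W * s) - max 0 (int rl - (int (W * T) - int (W * s)))) \<and>
     p powi int (W * s) \<le> best_blocking_prob C Y t rl \<and>
     ((T = s \<longrightarrow> W = 1 \<or> s = 1) \<and> best_blocking_prob C Y t rl \<noteq> p powi int (W * s) \<longrightarrow>
        W = 1 \<and> int T - int s < int rl \<and> rl < T)"
proof -
  let ?q = "T div s"
  have Ws: "0 < W" "0 < s" "s dvd T" and finU: "finite (drives U)"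
    using uncoded T unfolding uncoded_striped_def by auto
  have Tq: "T = s * ?q" using Ws by simp
  have "0 < T" using T by simp
  hence q: "0 < ?q" using Tq by (metis gr0I mult_0_right less_irrefl)
  have "real T / real s = real ?q" using Ws by (simp add: real_of_nat_div)
  with rl have "real (r * ?q) \<le> real rl" "real rl < real ((r + 1) * ?q)" by (simp_all only: of_nat_mult)
  hence rq: "r * ?q \<le> rl" "rl < (r + 1) * ?q" unfolding of_nat_le_iff of_nat_less_iff .
  \<comment> \<open>The window for the rank is a half-open interval of length \<open>?q\<close>
    starting at \<open>r * ?q\<close>, so the floor in the upper bound is exactly
    \<open>r\<close>.\<close>
  hence rl_div: "rl div ?q = r"
    by (intro div_nat_eqI) (simp_all add: mult.commute)
  have rs: "r + 1 \<le> s" using r Ws by auto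
  hence "(r + 1) * ?q \<le> T" using Tq by (metis mult_le_mono1)
  hence rlT: "rl < T" using rq by simp
  have sWs: "s \<le> W * s" using Ws(1) by simp
  have rWs: "r + 1 \<le> W * s" using rs sWs by linarith
  have floor: "\<lfloor>real rl / (real T / real s)\<rfloor> = int r"
    using rl_div \<open>real T / real s = real ?q\<close> by (simp add: floor_divide_of_nat_eq)
  have finC: "finite (drives C)" "\<And>d. d \<in> drives C \<Longrightarrow> finite (content C d)"
    and "card (drives C) = W * s"
    using coded card_content_union_coded(2)[OF coded] unfolding coded_striped_def by auto
  hence p1: "p \<le> 1"
    using blocking_parameter_le_1[OF service_C] rWs by fastforce
  note ext = extremal_blocking_prob_coded[OF coded service_C p_pos rlT[unfolded T], folded T]
  \<comment> \<open>The claims use integer exponents, the lemmas truncated natural ones; the two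
    agree up to \<open>k = W * s\<close>.\<close>
  have powi: "p powi (int (W * s) - int k) = p ^ (W * s - k)" if "k \<le> W * s" for k
    using that by (metis of_nat_diff power_int_of_nat)
  \<comment> \<open>As the floor equals \<open>r\<close>, the first inequality claimed for the upper
    bound holds with equality.\<close>
  have worst: "worst_blocking_prob C Y t rl = p powi (int (W * s) - int r)"
    using ext(2) rl_div rWs powi[of r] by simp
  \<comment> \<open>\<open>e\<close> is the number of drives exhausted even under the best
    distribution; truncated subtraction plays the role of the maximum with 0.\<close>
  define e where "e = rl - (W * T - W * s)"
  have sT: "W * s \<le> W * T" using Ws \<open>0 < T\<close> by (simp add: dvd_imp_le)
  have e: "max 0 (int rl - (int (W * T) - int (W * s))) = int e"
    unfolding e_def using sT by linarith
  have "T \<le> W * T" using Ws by simp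
  hence eWs: "e \<le> W * s" using rlT sT unfolding e_def by linarith
  have best: "best_blocking_prob C Y t rl = p powi (int (W * s) - int e)"
    using ext(3) powi[OF eWs] unfolding e_def by simp
  have "internal_blocking_prob U X u t K = p powi (int (W * s) - int (W * r))"
    if "0 < \<P>(w in pspace X. leader_holds U X u t K w)" "card {S \<in> P. decoded U K S} = r" for u K
  proof -
    have "int (W * (s - r)) = int (W * s) - int (W * r)"
      using rs by (simp add: of_nat_diff right_diff_distrib)
    thus ?thesis
      using internal_blocking_prob_eq[OF service_U finU _ that(1)]
        card_useful_uncoded[OF uncoded, of K] that(2)
      by (metis finite power_int_of_nat)
  qed
  moreover have "best_blocking_prob C Y t rl \<le> internal_blocking_prob C Y u t K \<and>
      internal_blocking_prob C Y u t K \<le> worst_blocking_prob C Y t rl"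
    if pos: "0 < \<P>(w in pspace Y. leader_holds C Y u t K w)" and "krank C K = rl" for u K
  proof -
    \<comment> \<open>A set held with positive probability belongs to the family over which worst
      and best case are taken, and conditioning on it leaves the same power of
      \<open>p\<close>.\<close>
    have "K \<subseteq> chunks C \<and> card K = rl \<and> krank C K = rl"
      using leader_holds_chunks[OF service_C pos] that(2) by simp
    moreover have "internal_blocking_prob C Y u t K = blocking_prob C Y t K"
      using internal_blocking_prob_eq[OF service_C finC pos] blocking_prob_eq[OF service_C finC(1)]
      by simp
    ultimately have "internal_blocking_prob C Y u t K \<in>
        {blocking_prob C Y t K |K. K \<subseteq> chunks C \<and> card K = rl \<and> krank C K = rl}" by blast
    thus ?thesis
      unfolding best_blocking_prob_def worst_blocking_prob_def
      using ext(1) by (intro conjI Min_le Max_ge)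
  qed
  \<comment> \<open>Strictness needs \<open>p < 1\<close>: for \<open>p = 1\<close> all powers
    coincide.\<close>
  moreover have "p powi (int (W * s) - int r) < p powi (int (W * s) - int (r + 1))" if "p < 1"
    using p_pos that by (intro power_int_strict_decreasing) auto
  moreover have "p powi int (W * s) \<le> p powi (int (W * s) - int e)"
    using p_pos p1 by (intro power_int_decreasing) auto
  moreover have "W = 1 \<and> int T - int s < int rl \<and> rl < T"
    if "T = s \<longrightarrow> W = 1 \<or> s = 1" "best_blocking_prob C Y t rl \<noteq> p powi int (W * s)"
  proof -
    have "e \<noteq> 0" using that(2) best by (intro notI) simp
    hence rl_gt: "W * T - W * s < rl" unfolding e_def by simp
    \<comment> \<open>With at least two copies, \<open>W * (T - s) < T\<close> gives
      \<open>T < 2 * s\<close>, and divisibility forces \<open>T = s\<close>. Then every drive holds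
      a single chunk and each received chunk exhausts a drive, so \<open>e = rl\<close>; this is why
      the case \<open>T = s\<close> with \<open>W\<close> and \<open>s\<close> both different from 1
      is excluded. What remains is \<open>T = 1\<close>, where \<open>rl = 0\<close> contradicts
      \<open>rl_gt\<close>.\<close>
    have "W = 1"
    proof (rule ccontr)
      assume "W \<noteq> 1"
      hence "2 \<le> W" using Ws by simp
      have "W * (T - s) < T" using rl_gt rlT by (simp add: right_diff_distrib')
      hence "2 * (T - s) < T" using \<open>2 \<le> W\<close> by (meson le_less_trans mult_le_mono1)
      hence "s * ?q < s * 2" using Tq by linarith
      hence "?q = 1" using q by simp
      hence "T = s" using Tq by simp
      with that(1) \<open>W \<noteq> 1\<close> have "T = 1" by simp
      with rlT rl_gt show False by simp
    qed
    thus ?thesis using rl_gt rlT sT by auto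
  qed
  ultimately show ?thesis
    unfolding floor e using worst best by auto
qed

end
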